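(* Let $\Omega$ be a Hausdorff space with Borel $\sigma$-algebra $\mathcal{B}$. The Cover-Hart class of loss functions on $\Omega$ is a convex cone; that is, if $L_1$ and $L_2$ belong to the Cover-Hart class and $c_1, c_2 \geq 0$ are real numbers, then $c_1 L_1 + c_2 L_2$ belongs to the Cover-Hart class.
   Context: Let $\mathcal{P}$ be the family of the Radon probability measures on the Hausdorff space $(\Omega,\mathcal{B})$, where $\mathcal{B}$ is the Borel $\sigma$-algebra. A function $L:\Omega\times\Omega\to\mathbb{R}$ is called measurable if it is measurable with respect to either argument when the other argument is fixed. The Cover-Hart class consists of the measurable functions $L:\Omega\times\Omega\to[0,\infty)$ such that $L(y,y)=0$ for all $y\in\Omega$, and $$\alpha \equiv \inf_{y\in\Omega} \mathbb{E}_P\, L(y,Y') \;\leq\; \beta \equiv \mathbb{E}_P\, L(Y,Y') \;\leq\; 2\alpha$$ for all $P\in\mathcal{P}$, where $Y$ and $Y'$ are independent with distribution $P$. Expectations of nonnegative functions may take the value $+\infty$. *)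

theory Defs
  imports "HOL-Probability.Probability"
begin

(* Local finiteness is automatic for a probability measure, and compact subsets
   of a Hausdorff space are closed, hence Borel. *)
definition radon_prob :: "'a::t2_space measure \<Rightarrow> bool" where
  "radon_prob P \<longleftrightarrow> prob_space P \<and> sets P = sets borel \<and>
     (\<forall>B\<in>sets borel. emeasure P B = (SUP K\<in>{K. compact K \<and> K \<subseteq> B}. emeasure P K))"

definition separately_measurable :: "('a::t2_space \<Rightarrow> 'a \<Rightarrow> real) \<Rightarrow> bool" where
  "separately_measurable L \<longleftrightarrow>
     (\<forall>y. (\<lambda>y'. L y y') \<in> borel_measurable borel) \<and>
     (\<forall>y'. (\<lambda>y. L y y') \<in> borel_measurable borel)"

definition cond_risk :: "'a measure \<Rightarrow> ('a \<Rightarrow> 'a \<Rightarrow> real) \<Rightarrow> 'a \<Rightarrow> ennreal" where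
  "cond_risk P L y = (\<integral>\<^sup>+y'. ennreal (L y y') \<partial>P)"

definition bayes_risk :: "'a measure \<Rightarrow> ('a \<Rightarrow> 'a \<Rightarrow> real) \<Rightarrow> ennreal" where
  "bayes_risk P L = (INF y. cond_risk P L y)"

(* The expectation of L(Y,Y') is the iterated integral, because a separately
   measurable L need not be measurable for the product sigma-algebra (a metric on
   a large discrete space is not). If L is jointly measurable, this is the
   expectation of L(Y,Y') for any independent Y, Y' with distribution P, see
   pair_risk_eq_expectation. If the outer integrand is not measurable,
   nn_integral is the lower integral. *)
definition pair_risk :: "'a measure \<Rightarrow> ('a \<Rightarrow> 'a \<Rightarrow> real) \<Rightarrow> ennreal" where
  "pair_risk P L = (\<integral>\<^sup>+y. \<integral>\<^sup>+y'. ennreal (L y y') \<partial>P \<partial>P)"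

lemma pair_risk_eq_expectation:
  fixes L :: "'a::t2_space \<Rightarrow> 'a \<Rightarrow> real"
  assumes "prob_space M"
    and indep: "prob_space.indep_var M borel Y borel Y'"
    and P: "distr M borel Y = P" "distr M borel Y' = P"
    and L[measurable]: "case_prod L \<in> borel_measurable (borel \<Otimes>\<^sub>M borel)"
  shows "pair_risk P L = (\<integral>\<^sup>+\<omega>. ennreal (L (Y \<omega>) (Y' \<omega>)) \<partial>M)"
proof -
  interpret M: prob_space M by fact
  have [measurable]: "Y \<in> borel_measurable M" "Y' \<in> borel_measurable M"
    and pair: "distr M borel Y \<Otimes>\<^sub>M distr M borel Y'
      = distr M (borel \<Otimes>\<^sub>M borel) (\<lambda>\<omega>. (Y \<omega>, Y' \<omega>))"
    using indep unfolding M.indep_var_distribution_eq by auto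
  have sets_P[measurable_cong]: "sets P = sets borel"
    using P by auto
  interpret P: prob_space P
    using M.prob_space_distr[of Y borel] P by simp
  have "pair_risk P L = (\<integral>\<^sup>+z. ennreal (case_prod L z) \<partial>(P \<Otimes>\<^sub>M P))"
    unfolding pair_risk_def by (subst P.nn_integral_fst[symmetric]) auto
  also have "\<dots> = (\<integral>\<^sup>+z. ennreal (case_prod L z)
      \<partial>distr M (borel \<Otimes>\<^sub>M borel) (\<lambda>\<omega>. (Y \<omega>, Y' \<omega>)))"
    using pair P by simp
  also have "\<dots> = (\<integral>\<^sup>+\<omega>. ennreal (L (Y \<omega>) (Y' \<omega>)) \<partial>M)"
    by (subst nn_integral_distr) auto
  finally show ?thesis .
qed

definition cover_hart :: "('a::t2_space \<Rightarrow> 'a \<Rightarrow> real) set" where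
  "cover_hart = {L. separately_measurable L \<and> (\<forall>y y'. 0 \<le> L y y') \<and> (\<forall>y. L y y = 0) \<and>
     (\<forall>P. radon_prob P \<longrightarrow>
        bayes_risk P L \<le> pair_risk P L \<and> pair_risk P L \<le> 2 * bayes_risk P L)}"

end

theory Submission
  imports Defs
begin

text \<open>
  Write \<open>f x = cond_risk P L x\<close>. The inequality \<open>bayes_risk \<le> pair_risk\<close> holds for every loss. For
  the upper bound, the Bayes risk is superadditive in \<open>L\<close>, so everything would follow if the pair
  risk, which is the integral of \<open>f\<close>, were additive. However, \<open>L\<close> is only separately measurable and
  \<open>f\<close> may be nonmeasurable; \<open>nn_integral\<close> is then a lower integral, which is merely superadditive, the
  wrong direction. The upper integral is subadditive, and the theorem follows once the Cover-Hart
  inequality is known in a stronger form: the \<^emph>\<open>upper\<close> integral of \<open>f\<close> is at most \<open>2 * f y\<close> for every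
  \<open>y\<close> (\<open>upper_nn_integral_cond_risk_le\<close>).

  This stronger form comes from testing the Cover-Hart inequality on measures \<open>p\<close> with countable
  support, for which no measurability question arises (\<open>cover_hart_pmf\<close>). Two-point measures show that
  \<open>L\<close> is symmetric and satisfies the triangle inequality up to a factor 2, which keeps all functions
  finite as soon as \<open>f y\<close> is finite. Next, \<open>P\<close> can be replaced by a \<open>p\<close> that nearly preserves the integral
  of \<open>L y\<close> and of one further measurable function \<open>g\<close>, while the mean of \<open>f\<close> under \<open>p\<close> is at least the
  upper integral \<open>U\<close> of \<open>f\<close>, up to \<open>e\<close> (\<open>pmf_approximating_upper_nn_integral\<close>): cut the space into
  countably many cells on which \<open>g\<close> and \<open>L y\<close> are nearly constant, and move the mass of each cell to a
  point where \<open>f\<close> is nearly maximal.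

  The pair risk of such a \<open>p\<close> itself says nothing about \<open>U\<close>, because \<open>p\<close> approximates \<open>P\<close> only on
  functions chosen in advance. But let \<open>S\<close> be the supremum of the pair risk over all \<open>p\<close> that have
  mean of \<open>f\<close> at least \<open>U - e\<close> and mean of \<open>L y\<close> at most \<open>f y + e\<close>; the Cover-Hart inequality gives
  \<open>S \<le> 2 * (f y + e)\<close>. Given a nearly optimal \<open>p\<close>, choose a second such measure \<open>p'\<close> adapted to
  \<open>g = cond_risk p L\<close>. By Fubini and symmetry the mixed risk of \<open>p\<close> and \<open>p'\<close> is about the mean of \<open>f\<close>
  under \<open>p\<close>, hence at least \<open>U - 2 * e\<close>. Moving from \<open>p\<close> a little towards \<open>p'\<close> stays in the class and
  raises the pair risk to first order by at least \<open>2 * t * (U - 2 * e - S)\<close>; as \<open>S\<close> is the supremum, this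
  cannot be positive, so \<open>U - 2 * e \<le> S \<le> 2 * (f y + e)\<close>. Let \<open>e\<close> tend to 0.
\<close>

section \<open>The upper integral\<close>

definition upper_nn_integral :: "'a measure \<Rightarrow> ('a \<Rightarrow> ennreal) \<Rightarrow> ennreal" where
  "upper_nn_integral M f = (INF F\<in>{F \<in> borel_measurable M. f \<le> F}. integral\<^sup>N M F)"

lemma upper_nn_integral_le:
  assumes "F \<in> borel_measurable M" and "\<And>x. f x \<le> F x"
  shows "upper_nn_integral M f \<le> integral\<^sup>N M F"
  unfolding upper_nn_integral_def using assms by (intro INF_lower) (auto simp: le_fun_def)

text \<open>The infimum is attained, by the pointwise infimum of a minimising sequence. One majorant
  thus serves for all comparisons, without an error term.\<close>

lemma measurable_majorant_exists:
  obtains F where "F \<in> borel_measurable M" "\<And>x. f x \<le> F x"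
    "integral\<^sup>N M F = upper_nn_integral M f"
proof -
  let ?A = "{F \<in> borel_measurable M. f \<le> F}"
  have ne: "?A \<noteq> {}"
    by (auto intro!: exI[of _ "\<lambda>_. \<infinity>"] simp: le_fun_def)
  obtain v :: "nat \<Rightarrow> ennreal" where v: "range v \<subseteq> integral\<^sup>N M ` ?A"
      and INF_v: "Inf (integral\<^sup>N M ` ?A) = (INF n. v n)"
    using ennreal_Inf_countable_INF[of "integral\<^sup>N M ` ?A"] ne by auto
  from v have "\<forall>n. \<exists>F. F \<in> ?A \<and> v n = integral\<^sup>N M F"
    by (auto simp: subset_eq image_iff)
  then obtain G where G: "\<And>n. G n \<in> ?A" "\<And>n. v n = integral\<^sup>N M (G n)"
    by metis
  have [measurable]: "G n \<in> borel_measurable M" for n using G(1) by auto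
  define F where "F = (\<lambda>x. INF n. G n x)"
  have F: "F \<in> borel_measurable M" unfolding F_def by measurable
  have le: "f x \<le> F x" for x
    unfolding F_def using G(1) by (auto intro!: INF_greatest simp: le_fun_def)
  have "integral\<^sup>N M F \<le> v n" for n
    unfolding G(2) F_def by (intro nn_integral_mono INF_lower) auto
  then have "integral\<^sup>N M F \<le> upper_nn_integral M f"
    unfolding upper_nn_integral_def INF_v by (intro INF_greatest)
  with upper_nn_integral_le[OF F le] F le show thesis
    by (intro that) auto
qed

section \<open>Measures with countable support\<close>

text \<open>The support is countable, so every set is, up to a null set, an increasing union of finite sets,
  and finite sets are compact.\<close>

lemma radon_prob_pmf: "radon_prob (distr (measure_pmf p) borel (\<lambda>x::'a::t2_space. x))"
proof -
  let ?D = "distr (measure_pmf p) borel (\<lambda>x. x)"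
  have em: "emeasure ?D B = emeasure (measure_pmf p) B" if "B \<in> sets borel" for B
    using that by (simp add: emeasure_distr)
  have cb: "K \<in> sets borel" if "compact K" for K :: "'a set"
    using that by (intro borel_closed compact_imp_closed)
  have "emeasure ?D B = (SUP K\<in>{K. compact K \<and> K \<subseteq> B}. emeasure ?D K)"
    if B: "B \<in> sets borel" for B
  proof (rule antisym)
    show "(SUP K\<in>{K. compact K \<and> K \<subseteq> B}. emeasure ?D K) \<le> emeasure ?D B"
      using B by (intro SUP_least emeasure_mono) auto
    show "emeasure ?D B \<le> (SUP K\<in>{K. compact K \<and> K \<subseteq> B}. emeasure ?D K)"
    proof (cases "B \<inter> set_pmf p = {}")
      case True
      then have "emeasure (measure_pmf p) B = 0"
        by (metis emeasure_Int_set_pmf emeasure_empty)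
      then show ?thesis using em[OF B] by simp
    next
      case False
      let ?K = "\<lambda>n. from_nat_into (B \<inter> set_pmf p) ` {..n::nat}"
      have sub: "?K n \<subseteq> B \<inter> set_pmf p" for n
        using from_nat_into[OF False] by blast
      have "emeasure ?D B = emeasure (measure_pmf p) (B \<inter> set_pmf p)"
        by (simp add: em B emeasure_Int_set_pmf)
      also have "B \<inter> set_pmf p = (\<Union>n. ?K n)"
        using range_from_nat_into[OF False] by (auto simp: set_eq_iff image_iff) blast+
      also have "emeasure (measure_pmf p) (\<Union>n. ?K n) = (SUP n. emeasure (measure_pmf p) (?K n))"
        by (intro SUP_emeasure_incseq[symmetric]) (auto simp: incseq_def)
      also have "\<dots> = (SUP n. emeasure ?D (?K n))"
        by (intro SUP_cong refl em[symmetric] cb finite_imp_compact) auto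
      also have "\<dots> \<le> (SUP K\<in>{K. compact K \<and> K \<subseteq> B}. emeasure ?D K)"
        using sub by (intro SUP_least SUP_upper) (auto intro!: finite_imp_compact)
      finally show ?thesis .
    qed
  qed
  then show ?thesis
    unfolding radon_prob_def by (auto intro!: measure_pmf.prob_space_distr)
qed

text \<open>Fubini when one of the two measures is a countable sum of point masses: separate measurability
  of \<open>f\<close> suffices.\<close>

lemma nn_integral_pmf_commute:
  fixes f :: "'b \<Rightarrow> 'a \<Rightarrow> ennreal"
  assumes f[measurable]: "\<And>x. f x \<in> borel_measurable M"
  shows "(\<integral>\<^sup>+y. \<integral>\<^sup>+x. f x y \<partial>measure_pmf p \<partial>M) = (\<integral>\<^sup>+x. \<integral>\<^sup>+y. f x y \<partial>M \<partial>measure_pmf p)"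
    and "(\<lambda>y. \<integral>\<^sup>+x. f x y \<partial>measure_pmf p) \<in> borel_measurable M"
proof -
  have *: "(\<integral>\<^sup>+x. u x \<partial>measure_pmf p) =
      (\<integral>\<^sup>+x. ennreal (pmf p x) * u x \<partial>count_space (set_pmf p))" for u :: "'b \<Rightarrow> ennreal"
    unfolding nn_integral_measure_pmf
    by (subst (2) nn_integral_count_space_indicator)
       (auto intro!: nn_integral_cong simp: indicator_def set_pmf_iff)
  show "(\<integral>\<^sup>+y. \<integral>\<^sup>+x. f x y \<partial>measure_pmf p \<partial>M) = (\<integral>\<^sup>+x. \<integral>\<^sup>+y. f x y \<partial>M \<partial>measure_pmf p)"
    unfolding * by (subst nn_integral_count_space_nn_integral) (auto simp: nn_integral_cmult)
  have "(\<lambda>(x, y). ennreal (pmf p x) * f x y) \<in> borel_measurable (count_space (set_pmf p) \<Otimes>\<^sub>M M)"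
    by (intro measurable_pair_measure_countable1) auto
  from measurable_pair_swap[OF this]
  have "(\<lambda>(y, x). ennreal (pmf p x) * f x y) \<in> borel_measurable (M \<Otimes>\<^sub>M count_space (set_pmf p))"
    by simp
  then have "(\<lambda>y. \<integral>\<^sup>+x. ennreal (pmf p x) * f x y \<partial>count_space (set_pmf p)) \<in> borel_measurable M"
    by (intro sigma_finite_measure.borel_measurable_nn_integral
        sigma_finite_measure_count_space_countable)
       auto
  then show "(\<lambda>y. \<integral>\<^sup>+x. f x y \<partial>measure_pmf p) \<in> borel_measurable M"
    unfolding * .
qed

definition mixture_pmf :: "real \<Rightarrow> 'a pmf \<Rightarrow> 'a pmf \<Rightarrow> 'a pmf" where
  "mixture_pmf t p q = bind_pmf (bernoulli_pmf t) (\<lambda>b. if b then p else q)"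

lemma nn_integral_mixture_pmf:
  assumes "0 < t" "t < 1"
  shows "(\<integral>\<^sup>+x. u x \<partial>mixture_pmf t p q) =
    ennreal t * (\<integral>\<^sup>+x. u x \<partial>p) + ennreal (1 - t) * (\<integral>\<^sup>+x. u x \<partial>q)"
  using assms by (simp add: mixture_pmf_def mult.commute)

lemma cond_risk_mixture:
  assumes "0 < t" "t < 1"
  shows "cond_risk (mixture_pmf t p q) L y =
    ennreal t * cond_risk p L y + ennreal (1 - t) * cond_risk q L y"
  unfolding cond_risk_def by (rule nn_integral_mixture_pmf[OF assms])

text \<open>The pair risk is a quadratic form in the measure; the middle term is its polarisation.\<close>

lemma pair_risk_mixture:
  assumes t: "0 < t" "t < 1"
  shows "pair_risk (mixture_pmf t p q) L =
    ennreal (t\<^sup>2) * pair_risk p L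
    + ennreal (t * (1 - t)) * ((\<integral>\<^sup>+x. cond_risk q L x \<partial>p) + (\<integral>\<^sup>+x. cond_risk p L x \<partial>q))
    + ennreal ((1 - t)\<^sup>2) * pair_risk q L"
proof -
  have pr: "pair_risk N L = (\<integral>\<^sup>+x. cond_risk N L x \<partial>N)" for N
    by (simp add: pair_risk_def cond_risk_def)
  define r where "r = 1 - t"
  have "0 \<le> r" using t by (simp add: r_def)
  then show ?thesis
    using t unfolding pr nn_integral_mixture_pmf[OF t] cond_risk_mixture[OF t] r_def[symmetric]
    by (simp add: nn_integral_add nn_integral_cmult ennreal_mult power2_eq_square
        distrib_left mult.assoc mult.left_commute add.assoc)
qed

section \<open>Consequences of the Cover-Hart inequality for discrete measures\<close>

text \<open>The inner integral over \<open>p\<close> is a countable sum of Borel functions, so the outer integrand is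
  Borel and the integrals over \<open>p\<close> and over its restriction to the Borel sets agree.\<close>

lemma cover_hart_pmf:
  assumes L: "L \<in> cover_hart"
  shows "pair_risk (measure_pmf p) L \<le> 2 * cond_risk (measure_pmf p) L y"
proof -
  have [measurable]: "\<And>x. L x \<in> borel_measurable borel" "\<And>y. (\<lambda>x. L x y) \<in> borel_measurable borel"
    using L by (auto simp: cover_hart_def separately_measurable_def)
  let ?D = "distr (measure_pmf p) borel (\<lambda>x. x)"
  have c: "cond_risk ?D L = cond_risk (measure_pmf p) L"
    unfolding cond_risk_def by (subst nn_integral_distr) auto
  have [measurable]: "cond_risk (measure_pmf p) L \<in> borel_measurable borel"
    using nn_integral_pmf_commute(2)[of "\<lambda>x' x. ennreal (L x x')" borel p]
    by (simp add: cond_risk_def[abs_def])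
  have "pair_risk (measure_pmf p) L = pair_risk ?D L"
    unfolding pair_risk_def cond_risk_def[symmetric] c
    by (subst nn_integral_distr) auto
  also have "\<dots> \<le> 2 * bayes_risk ?D L"
    using L radon_prob_pmf[of p] by (auto simp: cover_hart_def)
  also have "\<dots> \<le> 2 * cond_risk ?D L y"
    unfolding bayes_risk_def by (intro mult_left_mono INF_lower) auto
  finally show ?thesis by (simp add: c)
qed

lemma pair_risk_two_point:
  assumes t: "0 < t" "t < 1" and "L a a = 0" "L b b = 0" "L a b \<ge> 0" "L b a \<ge> 0"
  shows "pair_risk (mixture_pmf t (return_pmf a) (return_pmf b)) L =
    ennreal (t * (1 - t) * (L a b + L b a))"
  using assms unfolding pair_risk_mixture[OF t]
  by (simp add: pair_risk_def cond_risk_def ennreal_mult)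

lemma cond_risk_two_point:
  assumes t: "0 < t" "t < 1" and "L y a \<ge> 0" "L y b \<ge> 0"
  shows "cond_risk (mixture_pmf t (return_pmf a) (return_pmf b)) L y =
    ennreal (t * L y a + (1 - t) * L y b)"
  using assms unfolding cond_risk_mixture[OF t]
  by (simp add: cond_risk_def ennreal_mult)

lemma cover_hart_two_point:
  assumes L: "L \<in> cover_hart" and t: "0 < t" "t < 1"
  shows "t * (1 - t) * (L a b + L b a) \<le> 2 * (t * L y a + (1 - t) * L y b)"
proof -
  have nn: "0 \<le> L x z" "L x x = 0" for x z
    using L by (auto simp: cover_hart_def)
  have "ennreal (t * (1 - t) * (L a b + L b a)) \<le> 2 * ennreal (t * L y a + (1 - t) * L y b)"
    using cover_hart_pmf[OF L, of "mixture_pmf t (return_pmf a) (return_pmf b)" y]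
    by (simp add: pair_risk_two_point cond_risk_two_point t nn)
  also have "\<dots> = ennreal (2 * (t * L y a + (1 - t) * L y b))"
    using t nn by (subst ennreal_mult) auto
  finally show ?thesis
    using t nn by (subst (asm) ennreal_le_iff) auto
qed

text \<open>Put mass \<open>t\<close> on \<open>a\<close> and \<open>1 - t\<close> on \<open>b\<close>, and compare with the guess \<open>y = a\<close>. Both sides of the
  inequality vanish as \<open>t\<close> tends to 1, and the comparison of the first-order terms gives
  \<open>L b a \<le> L a b\<close>.\<close>

lemma cover_hart_sym:
  assumes L: "L \<in> cover_hart"
  shows "L a b = L b a"
proof -
  have "L b a \<le> L a b" for a b
  proof (rule ccontr)
    assume neg: "\<not> L b a \<le> L a b"
    have nn: "0 \<le> L x z" "L x x = 0" for x z
      using L by (auto simp: cover_hart_def)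
    have *: "t * (L a b + L b a) \<le> 2 * L a b" if t: "0 < t" "t < 1" for t
    proof -
      have "(1 - t) * (t * (L a b + L b a)) \<le> (1 - t) * (2 * L a b)"
        using cover_hart_two_point[OF L t, of a b a] nn by (simp add: algebra_simps)
      then show ?thesis using t by (subst (asm) mult_le_cancel_left_pos) auto
    qed
    have "L a b + L b a \<le> 2 * L a b"
      by (rule field_le_mult_one_interval) (use * in auto)
    with neg show False by simp
  qed
  then show ?thesis by (intro antisym)
qed

lemma cover_hart_quasi_triangle:
  assumes L: "L \<in> cover_hart"
  shows "L a b \<le> 2 * L y a + 2 * L y b"
  using cover_hart_two_point[OF L, of "1/2" a b y] cover_hart_sym[OF L, of a b] by simp

lemma cond_risk_quasi_triangle:
  assumes L: "L \<in> cover_hart" and "prob_space M" and [measurable]: "L y \<in> borel_measurable M"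
  shows "cond_risk M L x \<le> ennreal (2 * L y x) + 2 * cond_risk M L y"
proof -
  interpret prob_space M by fact
  have nn: "0 \<le> L x z" for x z
    using L by (auto simp: cover_hart_def)
  have "cond_risk M L x \<le> (\<integral>\<^sup>+x'. ennreal (2 * L y x) + 2 * ennreal (L y x') \<partial>M)"
    unfolding cond_risk_def
  proof (intro nn_integral_mono)
    fix x'
    have "ennreal (L x x') \<le> ennreal (2 * L y x + 2 * L y x')"
      using cover_hart_quasi_triangle[OF L] by (intro ennreal_leI)
    also have "\<dots> = ennreal (2 * L y x) + 2 * ennreal (L y x')"
      using nn by (simp add: ennreal_mult)
    finally show "ennreal (L x x') \<le> ennreal (2 * L y x) + 2 * ennreal (L y x')" .
  qed
  also have "\<dots> = ennreal (2 * L y x) + 2 * cond_risk M L y"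
    by (simp add: nn_integral_add nn_integral_cmult cond_risk_def emeasure_space_1)
  finally show ?thesis .
qed

lemma abs_diff_le_if_same_floor:
  fixes a b e :: real
  assumes "e > 0" and "\<lfloor>a / e\<rfloor> = \<lfloor>b / e\<rfloor>"
  shows "a \<le> b + e"
proof -
  have "a / e < b / e + 1" using assms(2) by linarith
  then show ?thesis using assms(1) by (simp add: field_simps)
qed

section \<open>Discretisation\<close>

text \<open>Discretisation adapted to finitely many functions: \<open>g\<close> and \<open>h\<close> vary by at most \<open>e\<close> on each cell,
  so moving the mass within the cells changes their integrals by at most \<open>e\<close>. The cellwise supremum
  of \<open>f\<close> is a measurable majorant of \<open>f\<close>, since it depends only on the cell; concentrating each cell
  at a point where \<open>f\<close> is within \<open>e\<close> of this supremum therefore recovers the upper integral. The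
  growth bound on \<open>f\<close> makes these suprema finite, so that such points exist.\<close>

lemma pmf_approximating_upper_nn_integral:
  fixes f :: "'a \<Rightarrow> ennreal" and g h :: "'a \<Rightarrow> real"
  assumes "prob_space M" and space: "space M = UNIV"
    and [measurable]: "g \<in> borel_measurable M" "h \<in> borel_measurable M"
    and g: "\<And>x. 0 \<le> g x" and h: "\<And>x. 0 \<le> h x"
    and f: "\<And>x. f x \<le> ennreal (c * h x + d)" and "0 \<le> c"
    and e: "0 < e"
  obtains p :: "'a pmf" where
    "upper_nn_integral M f \<le> (\<integral>\<^sup>+x. f x \<partial>p) + ennreal e"
    "(\<integral>\<^sup>+x. ennreal (g x) \<partial>M) \<le> (\<integral>\<^sup>+x. ennreal (g x) \<partial>p) + ennreal e"
    "(\<integral>\<^sup>+x. ennreal (h x) \<partial>p) \<le> (\<integral>\<^sup>+x. ennreal (h x) \<partial>M) + ennreal e"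
proof -
  interpret prob_space M by fact
  define cell where "cell x = (\<lfloor>g x / e\<rfloor>, \<lfloor>h x / e\<rfloor>)" for x
  have cell[measurable]: "cell \<in> M \<rightarrow>\<^sub>M count_space UNIV"
    unfolding cell_def[abs_def] by measurable
  have same_cell: "g x \<le> g z + e" "h x \<le> h z + e" if "cell x = cell z" for x z
    using that abs_diff_le_if_same_floor[OF e] by (auto simp: cell_def)
  define F where "F k = (SUP z\<in>{z. cell z = k}. f z)" for k
  have f_le_F: "f x \<le> F (cell x)" for x
    unfolding F_def by (intro SUP_upper) auto
  have F_fin: "F (cell x) \<noteq> \<infinity>" for x
  proof -
    have "F (cell x) \<le> ennreal (c * (h x + e) + d)"
      unfolding F_def
    proof (intro SUP_least)
      fix z assume "z \<in> {z. cell z = cell x}"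
      then have "h z \<le> h x + e" using same_cell[of z x] by auto
      then have "c * h z + d \<le> c * (h x + e) + d"
        using \<open>0 \<le> c\<close> by (intro add_right_mono mult_left_mono)
      then show "f z \<le> ennreal (c * (h x + e) + d)"
        by (intro order_trans[OF f] ennreal_leI)
    qed
    then show ?thesis by (auto simp: top_unique)
  qed
  have "\<exists>z. cell z = cell x \<and> F (cell x) \<le> f z + ennreal e" for x
  proof (cases "F (cell x) = 0")
    case True
    then show ?thesis by (intro exI[of _ x]) auto
  next
    case False
    then have "F (cell x) - ennreal e < F (cell x)"
      using F_fin[of x] e by (intro ennreal_between) (auto simp: zero_less_iff_neq_zero top.not_eq_extremum)
    then obtain z where "cell z = cell x" "F (cell x) - ennreal e < f z"
      by (auto simp: F_def less_SUP_iff)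
    then show ?thesis
      by (intro exI[of _ z]) (auto simp: ennreal_minus_le_iff add.commute dest!: less_imp_le)
  qed
  then have "\<forall>k\<in>range cell. \<exists>z. cell z = k \<and> F k \<le> f z + ennreal e"
    by blast
  then obtain pick where pick: "\<forall>k\<in>range cell. cell (pick k) = k \<and> F k \<le> f (pick k) + ennreal e"
    by metis
  define s where "s x = pick (cell x)" for x
  have s: "cell (s x) = cell x" "F (cell x) \<le> f (s x) + ennreal e" for x
    using pick by (auto simp: s_def)
  have s_meas[measurable]: "s \<in> M \<rightarrow>\<^sub>M count_space UNIV"
    unfolding s_def[abs_def] by measurable
  interpret D: prob_space "distr M (count_space UNIV) s"
    by (rule prob_space_distr) simp
  \<comment> \<open>There are only countably many cells, so the image of M under s is a probability mass function.\<close>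
  have "AE x in distr M (count_space UNIV) s. x \<in> range pick"
    by (subst AE_distr_iff) (auto simp: s_def)
  then have "AE x in distr M (count_space UNIV) s. measure (distr M (count_space UNIV) s) {x} \<noteq> 0"
    by (subst D.AE_support_countable) (auto intro!: exI[of _ "range pick"])
  then have p: "measure_pmf (Abs_pmf (distr M (count_space UNIV) s)) = distr M (count_space UNIV) s"
    using D.prob_space_axioms by (intro Abs_pmf_inverse) auto
  have int: "(\<integral>\<^sup>+x. u x \<partial>Abs_pmf (distr M (count_space UNIV) s)) = (\<integral>\<^sup>+x. u (s x) \<partial>M)"
    for u :: "'a \<Rightarrow> ennreal"
    unfolding p by (subst nn_integral_distr) auto
  have add_e: "(\<integral>\<^sup>+x. u x \<partial>M) + ennreal e = (\<integral>\<^sup>+x. u x + ennreal e \<partial>M)"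
    if "u \<in> borel_measurable M" for u
    using that by (simp add: nn_integral_add emeasure_space_1)
  have meas_s: "(\<lambda>x. u (s x)) \<in> borel_measurable M" for u :: "'a \<Rightarrow> ennreal"
    by (rule measurable_compose[OF s_meas]) simp
  show thesis
  proof (rule that[of "Abs_pmf (distr M (count_space UNIV) s)"], unfold int)
    have "upper_nn_integral M f \<le> (\<integral>\<^sup>+x. F (cell x) \<partial>M)"
      by (intro upper_nn_integral_le f_le_F) measurable
    also have "\<dots> \<le> (\<integral>\<^sup>+x. f (s x) \<partial>M) + ennreal e"
      unfolding add_e[OF meas_s] by (intro nn_integral_mono s)
    finally show "upper_nn_integral M f \<le> (\<integral>\<^sup>+x. f (s x) \<partial>M) + ennreal e" .
    show "(\<integral>\<^sup>+x. ennreal (g x) \<partial>M) \<le> (\<integral>\<^sup>+x. ennreal (g (s x)) \<partial>M) + ennreal e"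
      unfolding add_e[OF meas_s[of "\<lambda>x. ennreal (g x)"]]
      using same_cell(1)[OF s(1)[symmetric]] e g
      by (intro nn_integral_mono) (simp add: ennreal_plus[symmetric] del: ennreal_plus)
    have "(\<lambda>x. ennreal (h x)) \<in> borel_measurable M" by measurable
    from add_e[OF this]
    show "(\<integral>\<^sup>+x. ennreal (h (s x)) \<partial>M) \<le> (\<integral>\<^sup>+x. ennreal (h x) \<partial>M) + ennreal e"
      using same_cell(2)[OF s(1)] e h
      by (simp only:) (intro nn_integral_mono, simp add: ennreal_plus[symmetric] del: ennreal_plus)
  qed
qed


section \<open>The Cover-Hart inequality for the upper integral\<close>

text \<open>The hypothesis says that \<open>2 * t * (v - s)\<close> is at most of order \<open>t\<^sup>2\<close> as \<open>t\<close> tends to 0.\<close>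

lemma le_if_first_order_bound:
  fixes s v :: real
  assumes "0 \<le> s"
    and bound: "\<And>t. 0 < t \<Longrightarrow> t < 1 \<Longrightarrow> (1 - t)\<^sup>2 * s + 2 * t * (1 - t) * v \<le> s"
  shows "v \<le> s"
proof (rule ccontr)
  assume "\<not> v \<le> s"
  then have "s < v" "0 < v" using \<open>0 \<le> s\<close> by auto
  \<comment> \<open>The step for which the first-order gain 2 * t * (v - s) outweighs the loss t * t * (2 * v - s).\<close>
  define t where "t = (v - s) / (2 * v)"
  have t: "0 < t" "t < 1" "2 * t * v = v - s"
    using \<open>s < v\<close> \<open>0 < v\<close> \<open>0 \<le> s\<close> by (auto simp: t_def field_simps)
  have "t * (2 * (v - s) - t * (2 * v - s)) = (1 - t)\<^sup>2 * s + 2 * t * (1 - t) * v - s"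
    by (simp add: power2_eq_square algebra_simps)
  then have "t * (2 * (v - s) - t * (2 * v - s)) \<le> 0"
    using bound[OF t(1,2)] by simp
  then have "2 * (v - s) \<le> t * (2 * v - s)"
    using t(1) by (simp add: mult_le_0_iff)
  also have "t * (2 * v - s) = (v - s) - t * s"
    using t(3) by (simp add: algebra_simps)
  finally have "v - s + t * s \<le> 0" by simp
  moreover have "0 \<le> t * s" using t \<open>0 \<le> s\<close> by simp
  ultimately show False using \<open>s < v\<close> by linarith
qed

text \<open>The extremal argument: among the discrete measures whose mean of \<open>cond_risk P L\<close> nearly reaches its
  upper integral and whose mean of \<open>L y\<close> hardly exceeds the one under \<open>P\<close>, the pair risk has a finite
  supremum \<open>S\<close>, and first-order optimality shows that \<open>S\<close> is at least the upper integral, up to a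
  multiple of \<open>e\<close>.\<close>

lemma upper_nn_integral_cond_risk_le:
  assumes L: "L \<in> cover_hart" and P: "prob_space P" and sets_P: "sets P = sets borel"
  shows "upper_nn_integral P (cond_risk P L) \<le> 2 * cond_risk P L y"
proof (cases "cond_risk P L y")
  case top
  then show ?thesis by (simp add: ennreal_mult_top)
next
  case (real a)
  interpret prob_space P by fact
  have nn: "0 \<le> L x z" for x z
    using L by (auto simp: cover_hart_def)
  have [measurable]: "L x \<in> borel_measurable P" "(\<lambda>z. L z x) \<in> borel_measurable P" for x
    using L by (auto simp: cover_hart_def separately_measurable_def cong: measurable_cong_sets[OF sets_P refl])
  have space: "space P = UNIV"
    using sets_eq_imp_space_eq[OF sets_P] by simp
  let ?f = "cond_risk P L"
  let ?U = "upper_nn_integral P ?f"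
  have f_le: "?f x \<le> ennreal (2 * L y x + 2 * a)" for x
    using cond_risk_quasi_triangle[OF L P, of y x] nn[of y x] real by (simp add: ennreal_mult)
  have "?U \<le> (\<integral>\<^sup>+x. ennreal (2 * L y x + 2 * a) \<partial>P)"
    by (intro upper_nn_integral_le f_le) measurable
  also have "\<dots> = 2 * ?f y + ennreal (2 * a)"
    using nn real(1) by (simp add: cond_risk_def ennreal_mult nn_integral_add nn_integral_cmult emeasure_space_1)
  also have "\<dots> < \<infinity>"
    using real by (simp add: ennreal_mult_less_top)
  finally obtain u where u: "0 \<le> u" "?U = ennreal u"
    by (cases ?U) auto
  have main: "u \<le> 2 * a + 4 * e" if e: "0 < e" for e
  proof (rule ccontr)
    assume "\<not> u \<le> 2 * a + 4 * e"
    then have v_pos: "2 * (a + e) < u - 2 * e" by simp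
    define v where "v = u - 2 * e"
    define Mset where "Mset = {p. ?U \<le> (\<integral>\<^sup>+x. ?f x \<partial>measure_pmf p) + ennreal e \<and>
      cond_risk (measure_pmf p) L y \<le> ennreal (a + e)}"
    define S where "S = (SUP p\<in>Mset. pair_risk (measure_pmf p) L)"
    have "S \<le> ennreal (2 * (a + e))"
      unfolding S_def
    proof (intro SUP_least)
      fix p assume "p \<in> Mset"
      then have "2 * cond_risk (measure_pmf p) L y \<le> 2 * ennreal (a + e)"
        by (intro mult_left_mono) (auto simp: Mset_def)
      also have "\<dots> = ennreal (2 * (a + e))"
        using real e by (subst ennreal_mult) auto
      finally show "pair_risk (measure_pmf p) L \<le> ennreal (2 * (a + e))"
        using cover_hart_pmf[OF L, of p y] by (rule order_trans[rotated])
    qed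
    then obtain s where s: "0 \<le> s" "S = ennreal s" "s \<le> 2 * (a + e)"
      using real e by (cases S) (auto simp: top_unique simp del: ennreal_plus distrib_left_numeral)
    \<comment> \<open>The class contains a measure adapted to any one measurable function g.\<close>
    have ext: "\<exists>p\<in>Mset. (\<integral>\<^sup>+x. ennreal (g x) \<partial>P) \<le> (\<integral>\<^sup>+x. ennreal (g x) \<partial>measure_pmf p) + ennreal e"
      if g: "g \<in> borel_measurable P" "\<And>x. 0 \<le> g x" for g
    proof -
      obtain p where "?U \<le> (\<integral>\<^sup>+x. ?f x \<partial>measure_pmf p) + ennreal e"
          "(\<integral>\<^sup>+x. ennreal (g x) \<partial>P) \<le> (\<integral>\<^sup>+x. ennreal (g x) \<partial>measure_pmf p) + ennreal e"
          "(\<integral>\<^sup>+x. ennreal (L y x) \<partial>measure_pmf p) \<le> (\<integral>\<^sup>+x. ennreal (L y x) \<partial>P) + ennreal e"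
        by (rule pmf_approximating_upper_nn_integral[OF P space, of g "L y" ?f 2 "2 * a" e])
           (use g nn f_le e in auto)
      then show ?thesis
        using real e by (intro bexI[of _ p]) (auto simp: Mset_def cond_risk_def)
    qed
    \<comment> \<open>The supremum need not be attained, so the bound is first shown for each p in the class.\<close>
    have step: "(1 - t)\<^sup>2 * s + 2 * t * (1 - t) * v \<le> s" if t: "0 < t" "t < 1" for t
    proof -
      have r_le: "(1 - t)\<^sup>2 * r \<le> s - 2 * t * (1 - t) * v"
        if p: "p \<in> Mset" and r: "0 \<le> r" "pair_risk (measure_pmf p) L = ennreal r" for p r
      proof -
        have fp: "?U \<le> (\<integral>\<^sup>+x. ?f x \<partial>measure_pmf p) + ennreal e"
          and hp: "cond_risk (measure_pmf p) L y \<le> ennreal (a + e)"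
          using p by (auto simp: Mset_def)
        \<comment> \<open>The function that the second measure p' has to integrate correctly; it is finite by the quasi-triangle inequality.\<close>
        define g where "g x = enn2real (cond_risk (measure_pmf p) L x)" for x
        have "cond_risk (measure_pmf p) L x < \<infinity>" for x
        proof -
          have "cond_risk (measure_pmf p) L x \<le> ennreal (2 * L y x) + 2 * cond_risk (measure_pmf p) L y"
            by (intro cond_risk_quasi_triangle L measure_pmf.prob_space_axioms) auto
          also have "\<dots> \<le> ennreal (2 * L y x) + 2 * ennreal (a + e)"
            by (intro add_left_mono mult_left_mono hp) auto
          also have "\<dots> < \<infinity>" by (simp add: ennreal_mult_less_top)
          finally show ?thesis .
        qed
        then have g: "ennreal (g x) = cond_risk (measure_pmf p) L x" for x
          by (simp add: g_def)
        have "cond_risk (measure_pmf p) L \<in> borel_measurable P"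
          using nn_integral_pmf_commute(2)[of "\<lambda>x' x. ennreal (L x x')" P p]
          by (simp add: cond_risk_def[abs_def])
        then have "g \<in> borel_measurable P"
          unfolding g_def[abs_def] by measurable
        then obtain p' where p': "p' \<in> Mset"
          and gp': "(\<integral>\<^sup>+x. ennreal (g x) \<partial>P) \<le> (\<integral>\<^sup>+x. ennreal (g x) \<partial>measure_pmf p') + ennreal e"
          using ext[of g] by (auto simp: g_def)
        \<comment> \<open>Both cross terms reduce to this: N = P evaluates the mean of g under P, and N = p' makes the two mixed risks equal.\<close>
        have cross: "(\<integral>\<^sup>+x. cond_risk N L x \<partial>measure_pmf p) = (\<integral>\<^sup>+x. cond_risk (measure_pmf p) L x \<partial>N)"
          if "\<And>x. L x \<in> borel_measurable N" for N
          using nn_integral_pmf_commute(1)[of "\<lambda>x x'. ennreal (L x x')" N p] that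
          by (simp add: cond_risk_def cover_hart_sym[OF L, of _ "_::'a"])
        let ?X = "\<integral>\<^sup>+x. cond_risk (measure_pmf p) L x \<partial>measure_pmf p'"
        have "ennreal u \<le> (\<integral>\<^sup>+x. ?f x \<partial>measure_pmf p) + ennreal e"
          using fp u by simp
        also have "\<dots> \<le> ?X + ennreal e + ennreal e"
          using gp' unfolding g by (subst cross) (auto intro: add_right_mono)
        finally have vX: "ennreal v \<le> ?X"
          using u(1) e by (cases ?X) (auto simp: v_def ennreal_plus[symmetric] ennreal_le_iff2 simp del: ennreal_plus)
        \<comment> \<open>The conditions that define the class are affine in the measure, so the class is convex.\<close>
        define m where "m = mixture_pmf t p' p"
        have "m \<in> Mset"
        proof -
          have tt: "ennreal t * x + ennreal (1 - t) * x = x" for x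
            using t by (simp add: distrib_right[symmetric] ennreal_plus[symmetric] del: ennreal_plus)
          have "ennreal t * cond_risk (measure_pmf p') L y + ennreal (1 - t) * cond_risk (measure_pmf p) L y
            \<le> ennreal t * ennreal (a + e) + ennreal (1 - t) * ennreal (a + e)"
            using p' p by (intro add_mono mult_left_mono) (auto simp: Mset_def)
          moreover have "ennreal t * ?U + ennreal (1 - t) * ?U
            \<le> ennreal t * ((\<integral>\<^sup>+x. ?f x \<partial>measure_pmf p') + ennreal e)
              + ennreal (1 - t) * ((\<integral>\<^sup>+x. ?f x \<partial>measure_pmf p) + ennreal e)"
            using p' p by (intro add_mono mult_left_mono) (auto simp: Mset_def)
          moreover have "\<dots> = (ennreal t * (\<integral>\<^sup>+x. ?f x \<partial>measure_pmf p')
              + ennreal (1 - t) * (\<integral>\<^sup>+x. ?f x \<partial>measure_pmf p))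
              + (ennreal t * ennreal e + ennreal (1 - t) * ennreal e)"
            by (simp add: distrib_left add_ac)
          ultimately show ?thesis
            unfolding Mset_def m_def mem_Collect_eq nn_integral_mixture_pmf[OF t] cond_risk_mixture[OF t] tt
            by simp
        qed
        \<comment> \<open>The term t * t * pair_risk p' L is nonnegative and of second order, hence dropped.\<close>
        have "ennreal ((1 - t)\<^sup>2 * r + 2 * t * (1 - t) * v)
          = ennreal (t * (1 - t)) * (ennreal v + ennreal v) + ennreal ((1 - t)\<^sup>2) * ennreal r"
        proof -
          have "0 \<le> v" using v_pos real e by (simp add: v_def)
          then have "ennreal (t * (1 - t)) * (ennreal v + ennreal v) + ennreal ((1 - t)\<^sup>2) * ennreal r
            = ennreal (t * (1 - t) * (v + v) + (1 - t)\<^sup>2 * r)"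
            using t r by (simp add: ennreal_plus[symmetric] ennreal_mult[symmetric] del: ennreal_plus)
          also have "t * (1 - t) * (v + v) + (1 - t)\<^sup>2 * r = (1 - t)\<^sup>2 * r + 2 * t * (1 - t) * v"
            by (simp add: algebra_simps)
          finally show ?thesis by simp
        qed
        also have "\<dots> \<le> ennreal (t * (1 - t)) * (?X + ?X) + ennreal ((1 - t)\<^sup>2) * pair_risk (measure_pmf p) L"
          unfolding r by (intro add_mono mult_left_mono vX) auto
        also have "\<dots> \<le> pair_risk (measure_pmf m) L"
          unfolding m_def pair_risk_mixture[OF t] by (subst cross) (auto simp: add.assoc)
        also have "\<dots> \<le> ennreal s"
          unfolding s(2)[symmetric] S_def using \<open>m \<in> Mset\<close> by (intro SUP_upper)
        finally show ?thesis
          using s by simp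
      qed
      obtain p0 where "p0 \<in> Mset" using ext[of "\<lambda>_. 0"] by auto
      have fin: "\<exists>r\<ge>0. pair_risk (measure_pmf p) L = ennreal r" if "p \<in> Mset" for p
      proof -
        have "pair_risk (measure_pmf p) L \<le> ennreal s"
          unfolding s(2)[symmetric] S_def using that by (intro SUP_upper)
        then show ?thesis by (cases "pair_risk (measure_pmf p) L") (auto simp: top_unique)
      qed
      have "0 \<le> s - 2 * t * (1 - t) * v"
      proof -
        obtain r where "0 \<le> r" "pair_risk (measure_pmf p0) L = ennreal r"
          using fin \<open>p0 \<in> Mset\<close> by blast
        then have "(1 - t)\<^sup>2 * r \<le> s - 2 * t * (1 - t) * v" "0 \<le> (1 - t)\<^sup>2 * r"
          using r_le \<open>p0 \<in> Mset\<close> by auto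
        then show ?thesis by linarith
      qed
      have "S \<le> ennreal ((s - 2 * t * (1 - t) * v) / (1 - t)\<^sup>2)"
        unfolding S_def
      proof (intro SUP_least)
        fix p assume "p \<in> Mset"
        then obtain r where "0 \<le> r" "pair_risk (measure_pmf p) L = ennreal r"
          using fin by blast
        with r_le[OF \<open>p \<in> Mset\<close> this] t
        show "pair_risk (measure_pmf p) L \<le> ennreal ((s - 2 * t * (1 - t) * v) / (1 - t)\<^sup>2)"
          by (simp add: ennreal_leI field_simps)
      qed
      then have "s \<le> (s - 2 * t * (1 - t) * v) / (1 - t)\<^sup>2"
        using s \<open>0 \<le> s - 2 * t * (1 - t) * v\<close> by simp
      then show ?thesis
        using t by (simp add: field_simps)
    qed
    have "v \<le> s"
      using s(1) step by (rule le_if_first_order_bound)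
    with s(3) v_pos show False by (simp add: v_def)
  qed
  have "u \<le> 2 * a"
  proof (rule field_le_epsilon)
    fix e :: real assume "0 < e"
    with main[of "e / 4"] show "u \<le> 2 * a + e" by simp
  qed
  then show ?thesis
    using u real by (simp add: ennreal_mult[symmetric] ennreal_leI flip: ennreal_numeral)
qed

section \<open>Convexity of the Cover-Hart class\<close>

text \<open>An average is at least the infimum.\<close>

lemma bayes_risk_le_pair_risk:
  assumes "prob_space P"
  shows "bayes_risk P L \<le> pair_risk P L"
proof -
  interpret prob_space P by fact
  have "bayes_risk P L = (\<integral>\<^sup>+y. bayes_risk P L \<partial>P)"
    by (simp add: emeasure_space_1)
  also have "\<dots> \<le> pair_risk P L"
    unfolding pair_risk_def cond_risk_def[symmetric]
    by (intro nn_integral_mono) (auto simp: bayes_risk_def intro: INF_lower)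
  finally show ?thesis .
qed

theorem theorem2p2:
  fixes L1 L2 :: "'a::t2_space \<Rightarrow> 'a \<Rightarrow> real" and c1 c2 :: real
  assumes "L1 \<in> cover_hart" and "L2 \<in> cover_hart"
    and "c1 \<ge> 0" and "c2 \<ge> 0"
  shows "(\<lambda>y y'. c1 * L1 y y' + c2 * L2 y y') \<in> cover_hart"
proof -
  let ?L = "\<lambda>y y'. c1 * L1 y y' + c2 * L2 y y'"
  have nn: "0 \<le> L1 x z" "0 \<le> L2 x z" for x z
    using assms by (auto simp: cover_hart_def)
  have meas: "L1 x \<in> borel_measurable borel" "L2 x \<in> borel_measurable borel" for x
    using assms by (auto simp: cover_hart_def separately_measurable_def)
  have "separately_measurable ?L"
    using assms unfolding cover_hart_def separately_measurable_def
    by (auto intro!: borel_measurable_add borel_measurable_times)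
  moreover have "pair_risk P ?L \<le> 2 * bayes_risk P ?L" if "radon_prob P" for P
  proof -
    have P: "prob_space P" "sets P = sets borel"
      using that by (auto simp: radon_prob_def)
    have [measurable]: "L1 x \<in> borel_measurable P" "L2 x \<in> borel_measurable P" for x
      using meas by (auto cong: measurable_cong_sets[OF P(2) refl])
    have cr: "cond_risk P ?L y = ennreal c1 * cond_risk P L1 y + ennreal c2 * cond_risk P L2 y" for y
      using nn assms by (simp add: cond_risk_def ennreal_mult nn_integral_add nn_integral_cmult)
    obtain F1 where F1[measurable]: "F1 \<in> borel_measurable P" and F1_ge: "\<And>x. cond_risk P L1 x \<le> F1 x"
      and int1: "integral\<^sup>N P F1 = upper_nn_integral P (cond_risk P L1)"
      using measurable_majorant_exists[of P "cond_risk P L1"] by blast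
    obtain F2 where F2[measurable]: "F2 \<in> borel_measurable P" and F2_ge: "\<And>x. cond_risk P L2 x \<le> F2 x"
      and int2: "integral\<^sup>N P F2 = upper_nn_integral P (cond_risk P L2)"
      using measurable_majorant_exists[of P "cond_risk P L2"] by blast
    have "pair_risk P ?L \<le> 2 * cond_risk P ?L y" for y
    proof -
      have "pair_risk P ?L = (\<integral>\<^sup>+x. ennreal c1 * cond_risk P L1 x + ennreal c2 * cond_risk P L2 x \<partial>P)"
        unfolding cr[symmetric] by (simp add: pair_risk_def cond_risk_def)
      also have "\<dots> \<le> (\<integral>\<^sup>+x. ennreal c1 * F1 x + ennreal c2 * F2 x \<partial>P)"
        using F1_ge F2_ge by (intro nn_integral_mono add_mono mult_left_mono) auto
      also have "\<dots> = ennreal c1 * integral\<^sup>N P F1 + ennreal c2 * integral\<^sup>N P F2"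
        by (simp add: nn_integral_add nn_integral_cmult)
      also have "\<dots> \<le> ennreal c1 * (2 * cond_risk P L1 y) + ennreal c2 * (2 * cond_risk P L2 y)"
        unfolding int1 int2
        by (intro add_mono mult_left_mono upper_nn_integral_cond_risk_le assms P) auto
      also have "\<dots> = 2 * cond_risk P ?L y"
        unfolding cr by (simp add: distrib_left mult.left_commute)
      finally show ?thesis .
    qed
    \<comment> \<open>Halving turns the bound into a lower bound for the infimum itself.\<close>
    then have "pair_risk P ?L / 2 \<le> bayes_risk P ?L"
      unfolding bayes_risk_def
      by (intro INF_greatest divide_le_posI_ennreal) (auto simp: mult.commute)
    then have "2 * (pair_risk P ?L / 2) \<le> 2 * bayes_risk P ?L"
      by (intro mult_left_mono) auto
    then show ?thesis
      by (simp add: ennreal_times_divide mult_divide_eq_ennreal mult.commute[of 2])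
  qed
  moreover have "bayes_risk P ?L \<le> pair_risk P ?L" if "radon_prob P" for P
    using that by (intro bayes_risk_le_pair_risk) (auto simp: radon_prob_def)
  ultimately show ?thesis
    using assms unfolding cover_hart_def by auto
qed

end
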